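(* Let $\mathbf{X}$ be a random variable with probability mass function $f_{\mathbf{X}}$ supported on $\mathbb{Z}$, whose characteristic function $\Phi_{\mathbf{X}}$ has no zeros, and let $\{\hat{c}_{\mathbf{X}}[n]\}_{n\in\mathbb{Z}}$ be its complex muculants. Then the following properties hold: 1. $\hat{c}_{\mathbf{X}}[n]\in\mathbb{R}$ for all $n\in\mathbb{Z}$. 2. $\hat{c}_{\mathbf{X}}[0]\le 0$. 3. If $f_{\mathbf{X}}[\xi]=f_{\mathbf{X}}[-\xi]$ for all $\xi\in\mathbb{Z}$, then $\hat{c}_{\mathbf{X}}[n]=\hat{c}_{\mathbf{X}}[-n]$ for all $n\in\mathbb{Z}$. 4. If $\mathbf{X}$ has finite expectation, then $\sum_{n=-\infty}^{\infty}\hat{c}_{\mathbf{X}}[n]=0$ and the Fourier series $\sum_{n=-\infty}^{\infty}\hat{c}_{\mathbf{X}}[n]e^{\jmath\mu n}$ of $\log\Phi_{\mathbf{X}}(\mu)$ converges pointwise. 5. $\lim_{n\to\pm\infty}\hat{c}_{\mathbf{X}}[n]=0$. If $\mathbf{X}$ has finite expectation, then $\hat{c}_{\mathbf{X}}[n]=\mathcal{O}(1/n)$. 6. If $\mathbf{Y}$ is another random variable with values in $\mathbb{Z}$ whose characteristic function has no zeros, and $\mathbf{X}$ and $\mathbf{Y}$ are independent, then $\hat{c}_{\mathbf{X}+\mathbf{Y}}[n]=\hat{c}_{\mathbf{X}}[n]+\hat{c}_{\mathbf{Y}}[n]$ for all $n\in\mathbb{Z}$.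
   Context: $\jmath$ denotes the imaginary unit. For a random variable $\mathbf{X}$ with values in $\mathbb{Z}$, the probability mass function is $f_{\mathbf{X}}[\xi]=\mathbb{P}(\mathbf{X}=\xi)$, $\xi\in\mathbb{Z}$ ("supported on $\mathbb{Z}$" means that $\mathbf{X}$ takes values in $\mathbb{Z}$), and the characteristic function is $\Phi_{\mathbf{X}}(\mu)=\mathbb{E}(e^{\jmath\mu\mathbf{X}})=\sum_{\xi\in\mathbb{Z}}f_{\mathbf{X}}[\xi]e^{\jmath\mu\xi}$, $\mu\in\mathbb{R}$, which is $2\pi$-periodic. Finite expectation means $\mathbb{E}(|\mathbf{X}|)<\infty$. The complex logarithm of $\Phi_{\mathbf{X}}$ is $\log\Phi_{\mathbf{X}}(\mu)=\ln|\Phi_{\mathbf{X}}(\mu)|+\jmath\arg^*(\Phi_{\mathbf{X}}(\mu))$, where $\ln$ is the natural logarithm and $\mu\mapsto\arg^*(\Phi_{\mathbf{X}}(\mu))$ is the continuous (unwrapped) phase of $\Phi_{\mathbf{X}}$, normalized to be $0$ at $\mu=0$ (where $\Phi_{\mathbf{X}}(0)=1$). With this definition the logarithm of a product is the sum of the logarithms. The complex muculants $\{\hat{c}_{\mathbf{X}}[n]\}_{n\in\mathbb{Z}}$ are the Fourier series coefficients of $\log\Phi_{\mathbf{X}}$ on $[-\pi,\pi]$: $$\hat{c}_{\mathbf{X}}[n]=\frac{1}{2\pi}\int_{-\pi}^{\pi}\log\Phi_{\mathbf{X}}(\mu)\,e^{-\jmath\mu n}\,\mathrm{d}\mu .$$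 Doubly infinite sums $\sum_{n=-\infty}^{\infty}$ are understood, as usual for Fourier series, as limits of the symmetric partial sums $\sum_{n=-N}^{N}$ as $N\to\infty$. *)

theory Defs
  imports "HOL-Probability.Probability" "HOL-Library.Landau_Symbols"
begin

definition prob_mass :: "'a measure \<Rightarrow> ('a \<Rightarrow> int) \<Rightarrow> int \<Rightarrow> real" where
  "prob_mass M X \<xi> = measure M {\<omega> \<in> space M. X \<omega> = \<xi>}"

definition char_fun :: "'a measure \<Rightarrow> ('a \<Rightarrow> int) \<Rightarrow> real \<Rightarrow> complex" where
  "char_fun M X = char (distr M borel (\<lambda>\<omega>. real_of_int (X \<omega>)))"

(* For a continuous, nowhere vanishing \<Phi> with \<Phi> 0 = 1 there is exactly one such \<theta>. It lives
   on the whole real line and need not be 2 * pi periodic, even if \<Phi> is: \<Phi> may wind around 0. *)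
definition unwrapped_phase :: "(real \<Rightarrow> complex) \<Rightarrow> real \<Rightarrow> real" where
  "unwrapped_phase \<Phi> = (THE \<theta>. continuous_on UNIV \<theta> \<and> \<theta> 0 = 0 \<and>
     (\<forall>\<mu>. \<Phi> \<mu> = complex_of_real (cmod (\<Phi> \<mu>)) * cis (\<theta> \<mu>)))"

definition log_char :: "'a measure \<Rightarrow> ('a \<Rightarrow> int) \<Rightarrow> real \<Rightarrow> complex" where
  "log_char M X \<mu> = complex_of_real (ln (cmod (char_fun M X \<mu>)))
     + \<i> * complex_of_real (unwrapped_phase (char_fun M X) \<mu>)"

definition muculant :: "'a measure \<Rightarrow> ('a \<Rightarrow> int) \<Rightarrow> int \<Rightarrow> complex" where
  "muculant M X n = complex_of_real (1 / (2 * pi)) *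
     integral {-pi..pi} (\<lambda>\<mu>. log_char M X \<mu> * exp (- (\<i> * complex_of_real \<mu> * of_int n)))"

definition fourier_partial_sum :: "(int \<Rightarrow> complex) \<Rightarrow> real \<Rightarrow> nat \<Rightarrow> complex" where
  "fourier_partial_sum c \<mu> N =
     (\<Sum>n = - int N..int N. c n * exp (\<i> * complex_of_real \<mu> * of_int n))"

end

theory Submission
  imports Defs "HOL-Complex_Analysis.Weierstrass_Factorization"
begin

text \<open>Write \<open>\<Phi>\<close> for the characteristic function of \<open>X\<close> and \<open>\<psi>\<close> for its logarithm. On the real line a
  continuous logarithm that vanishes at \<open>0\<close> exists, as the line is contractible, and is unique, as two
  of them differ by a continuous function with values in \<open>2 \<pi> \<i> \<int>\<close>. Hence every identity for \<open>\<Phi>\<close> lifts to \<open>\<psi>\<close>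
  (\<open>log_char_unique\<close>): \<open>\<Phi> (- \<mu>) = cnj (\<Phi> \<mu>)\<close> makes the muculants real, a symmetric law makes \<open>\<Phi>\<close>
  and so \<open>\<psi>\<close> even, and a product of characteristic functions becomes a sum of logarithms. The bound
  \<open>\<bar>\<Phi>\<bar> \<le> 1\<close> gives \<open>Re \<psi> \<le> 0\<close>, hence the sign of the muculant of index \<open>0\<close>.

  The analytic claims are about Fourier coefficients on \<open>[-\<pi>, \<pi>]\<close>. They cannot appeal to periodicity
  of \<open>\<psi>\<close>: if \<open>\<Phi>\<close> winds around \<open>0\<close>, then \<open>\<psi> \<pi> \<noteq> \<psi> (-\<pi>)\<close>. The coefficients of a bounded function tend
  to \<open>0\<close> by Bessel's inequality (\<open>riemann_lebesgue\<close>). Finite expectation makes \<open>\<Phi>\<close> Lipschitz with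
  constant \<open>E \<bar>X\<bar>\<close>; as \<open>\<Phi>\<close> stays away from \<open>0\<close> on compact intervals, \<open>\<psi>\<close> is Lipschitz there as well
  (\<open>log_char_lipschitz\<close>), and this regularity suffices for everything else.

  Convergence at \<open>\<mu>\<^sub>0\<close> follows Chernoff's argument (\<open>fourier_partial_sum_tendsto\<close>): if
  \<open>f - L = g * (exp (\<i> (\<mu> - \<mu>\<^sub>0)) - 1)\<close> with bounded \<open>g\<close>, then the terms of the Fourier series of \<open>f - L\<close>
  at \<open>\<mu>\<^sub>0\<close> are differences of consecutive terms of that of \<open>g\<close>, so the symmetric sums telescope to two
  terms that tend to \<open>0\<close>. At an interior point this applies to \<open>\<psi>\<close> itself with \<open>L = \<psi> \<mu>\<^sub>0\<close>. At \<open>\<plusminus>\<pi>\<close>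
  it applies to the even part of \<open>\<psi>\<close>, which has the same symmetric partial sums there and takes the
  averaged value at both ends. The sum of all muculants is the series at \<open>0\<close>, where \<open>\<psi>\<close> vanishes.
  Finally, shifting the variable by half a period of the exponential, \<open>\<pi> / n\<close>, gives the decay
  \<open>O(1/n)\<close> (\<open>fourier_coeff_norm_le\<close>); the possible jump of \<open>\<psi>\<close> at the ends only costs two integrals over
  intervals of length \<open>\<pi> / n\<close>.\<close>

section \<open>Fourier coefficients of bounded functions\<close>

definition fourier_coeff :: "(real \<Rightarrow> complex) \<Rightarrow> int \<Rightarrow> complex" where
  "fourier_coeff f n = complex_of_real (1 / (2 * pi)) *
     integral {-pi..pi} (\<lambda>\<mu>. f \<mu> * exp (- (\<i> * complex_of_real \<mu> * of_int n)))"

lemma fourier_coeff_reflect: "fourier_coeff (\<lambda>\<mu>. f (- \<mu>)) n = fourier_coeff f (- n)"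
  using Henstock_Kurzweil_Integration.integral_reflect_real[of pi "-pi" "\<lambda>\<mu>. f \<mu> * exp (- (\<i> * complex_of_real \<mu> * of_int (-n)))"]
  by (simp add: fourier_coeff_def)

lemma fourier_coeff_cnj: "fourier_coeff (\<lambda>\<mu>. cnj (f \<mu>)) n = cnj (fourier_coeff f (- n))"
  unfolding fourier_coeff_def
  by (simp add: Henstock_Kurzweil_Integration.integral_cnj exp_cnj)

lemma fourier_integrand_integrable:
  assumes "continuous_on {-pi..pi} f"
  shows "(\<lambda>\<mu>. f \<mu> * exp (- (\<i> * complex_of_real \<mu> * of_int n))) integrable_on {-pi..pi}"
  by (intro integrable_continuous_real continuous_intros assms)

lemma fourier_coeff_add:
  assumes "continuous_on {-pi..pi} f" "continuous_on {-pi..pi} g"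
  shows "fourier_coeff (\<lambda>\<mu>. f \<mu> + g \<mu>) n = fourier_coeff f n + fourier_coeff g n"
  by (simp add: fourier_coeff_def ring_distribs Henstock_Kurzweil_Integration.integral_add
      fourier_integrand_integrable assms)

lemma fourier_coeff_cmult: "fourier_coeff (\<lambda>\<mu>. c * f \<mu>) n = c * fourier_coeff f n"
  by (simp add: fourier_coeff_def mult.assoc mult.left_commute)

lemma borel_measurable_cnj:
  fixes f :: "'b \<Rightarrow> complex"
  assumes "f \<in> borel_measurable M"
  shows "(\<lambda>x. cnj (f x)) \<in> borel_measurable M"
  by (rule borel_measurable_continuous_on[OF _ assms]) (intro continuous_intros)

text \<open>Expand the nonnegative integral of \<open>\<bar>f - S\<bar>\<^sup>2\<close>, where \<open>S\<close> is the orthogonal projection of \<open>f\<close> onto the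
  span of the \<open>e i\<close>. The \<open>e i\<close> have squared norm \<open>C\<close> instead of \<open>1\<close>, so that the plain exponentials
  on \<open>[-\<pi>, \<pi>]\<close> fit with \<open>C = 2 \<pi>\<close>.\<close>

lemma bessel_inequality:
  fixes f :: "'b \<Rightarrow> complex" and e :: "'i \<Rightarrow> 'b \<Rightarrow> complex"
  assumes "finite F" and "C > 0"
    and ff: "integrable M (\<lambda>x. f x * cnj (f x))"
    and fe: "\<And>i. i \<in> F \<Longrightarrow> integrable M (\<lambda>x. f x * cnj (e i x))"
    and ee: "\<And>i j. i \<in> F \<Longrightarrow> j \<in> F \<Longrightarrow> integrable M (\<lambda>x. e i x * cnj (e j x))"
    and orth: "\<And>i j. i \<in> F \<Longrightarrow> j \<in> F \<Longrightarrow>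
      (\<integral>x. e i x * cnj (e j x) \<partial>M) = (if i = j then complex_of_real C else 0)"
  shows "(\<Sum>i\<in>F. (cmod (\<integral>x. f x * cnj (e i x) \<partial>M))\<^sup>2) \<le> C * Re (\<integral>x. f x * cnj (f x) \<partial>M)"
proof -
  define b where "b i = (\<integral>x. f x * cnj (e i x) \<partial>M)" for i
  define a where "a i = b i / complex_of_real C" for i
  define S where "S x = (\<Sum>i\<in>F. a i * e i x)" for x
  have ef: "integrable M (\<lambda>x. e i x * cnj (f x))" "(\<integral>x. e i x * cnj (f x) \<partial>M) = cnj (b i)" if "i \<in> F" for i
  proof -
    have *: "(\<lambda>x. e i x * cnj (f x)) = (\<lambda>x. cnj (f x * cnj (e i x)))"
      by (auto simp: mult.commute)
    show "integrable M (\<lambda>x. e i x * cnj (f x))"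
      unfolding * using fe[OF that] by (subst integrable_cnj) auto
    show "(\<integral>x. e i x * cnj (f x) \<partial>M) = cnj (b i)"
      unfolding * b_def by (rule Bochner_Integration.integral_cnj)
  qed
  have expand: "(f x - S x) * cnj (f x - S x) = f x * cnj (f x) - (\<Sum>i\<in>F. cnj (a i) * (f x * cnj (e i x)))
      - (\<Sum>i\<in>F. a i * (e i x * cnj (f x))) + (\<Sum>i\<in>F. \<Sum>j\<in>F. a i * cnj (a j) * (e i x * cnj (e j x)))" for x
    unfolding S_def
    by (simp add: algebra_simps sum_distrib_left sum_distrib_right cnj_sum sum_product)
      (rule sum.swap)
  have "(\<integral>x. (f x - S x) * cnj (f x - S x) \<partial>M) = (\<integral>x. f x * cnj (f x) \<partial>M) - (\<Sum>i\<in>F. cnj (a i) * b i)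
      - (\<Sum>i\<in>F. a i * cnj (b i)) + (\<Sum>i\<in>F. \<Sum>j\<in>F. a i * cnj (a j) * (if i = j then complex_of_real C else 0))"
    unfolding expand
    by (simp add: ff fe ee ef orth b_def cong: sum.cong)
  also have "(\<Sum>i\<in>F. \<Sum>j\<in>F. a i * cnj (a j) * (if i = j then complex_of_real C else 0))
      = (\<Sum>i\<in>F. a i * cnj (b i))"
    using \<open>finite F\<close> \<open>C > 0\<close>
    by (intro sum.cong) (auto simp: a_def if_distrib[of "\<lambda>z. _ * z"] sum.delta cong: if_cong)
  finally have eq: "(\<integral>x. (f x - S x) * cnj (f x - S x) \<partial>M) = (\<integral>x. f x * cnj (f x) \<partial>M) - (\<Sum>i\<in>F. cnj (a i) * b i)"
    by simp
  have "0 \<le> (\<integral>x. (cmod (f x - S x))\<^sup>2 \<partial>M)"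
    by simp
  also have "\<dots> = Re (\<integral>x. (f x - S x) * cnj (f x - S x) \<partial>M)"
    unfolding complex_norm_square[symmetric] of_real_power[symmetric] integral_complex_of_real by simp
  finally have "Re (\<Sum>i\<in>F. cnj (a i) * b i) \<le> Re (\<integral>x. f x * cnj (f x) \<partial>M)"
    unfolding eq by simp
  moreover have "cnj (a i) * b i = complex_of_real ((cmod (b i))\<^sup>2 / C)" for i
    using complex_norm_square[of "b i"] by (simp add: a_def mult.commute)
  ultimately have "(\<Sum>i\<in>F. (cmod (b i))\<^sup>2) / C \<le> Re (\<integral>x. f x * cnj (f x) \<partial>M)"
    by (simp add: sum_divide_distrib)
  then show ?thesis
    using \<open>C > 0\<close> by (simp add: b_def field_simps)
qed

text \<open>For each \<open>r > 0\<close>, at most \<open>B / r\<^sup>2\<close> indices satisfy \<open>\<bar>a i\<bar> \<ge> r\<close>. Convergence along \<open>cofinite\<close> covers both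
  ends of the integers at once.\<close>

lemma square_bounded_sums_tendsto_0:
  fixes a :: "'i \<Rightarrow> complex"
  assumes B: "\<And>F. finite F \<Longrightarrow> (\<Sum>i\<in>F. (cmod (a i))\<^sup>2) \<le> B"
  shows "(a \<longlongrightarrow> 0) cofinite"
proof (rule tendstoI)
  fix r :: real assume "r > 0"
  have "finite {i. r \<le> cmod (a i)}"
  proof (rule ccontr)
    assume "infinite {i. r \<le> cmod (a i)}"
    then obtain F where F: "F \<subseteq> {i. r \<le> cmod (a i)}" "finite F" "card F = nat \<lceil>B / r\<^sup>2\<rceil> + 1"
      by (meson infinite_arbitrarily_large)
    have "B < real (card F) * r\<^sup>2"
      using \<open>r > 0\<close> F(3) by (simp add: pos_divide_less_eq[symmetric]) linarith
    also have "\<dots> = (\<Sum>i\<in>F. r\<^sup>2)" by simp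
    also have "\<dots> \<le> (\<Sum>i\<in>F. (cmod (a i))\<^sup>2)"
      using F(1) \<open>r > 0\<close> by (intro sum_mono power_mono) auto
    also have "\<dots> \<le> B" using B F(2) by blast
    finally show False by simp
  qed
  then show "\<forall>\<^sub>F i in cofinite. dist (a i) 0 < r"
    by (simp add: eventually_cofinite not_less)
qed

lemma int_at_top_le_cofinite: "(at_top :: int filter) \<le> cofinite"
proof (rule filter_leI)
  fix P :: "int \<Rightarrow> bool"
  assume "eventually P cofinite"
  then have "finite {n. \<not> P n}" by (simp add: eventually_cofinite)
  then obtain B where "\<forall>n\<in>{n. \<not> P n}. n \<le> B" using bdd_above_finite bdd_above_def by metis
  then show "eventually P at_top"
    by (intro eventually_at_top_linorderI[of "B + 1"]) force
qed

lemma int_at_bot_le_cofinite: "(at_bot :: int filter) \<le> cofinite"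
proof (rule filter_leI)
  fix P :: "int \<Rightarrow> bool"
  assume "eventually P cofinite"
  then have "finite {n. \<not> P n}" by (simp add: eventually_cofinite)
  then obtain B where "\<forall>n\<in>{n. \<not> P n}. B \<le> n" using bdd_below_finite bdd_below_def by metis
  then show "eventually P at_bot"
    by (intro eventually_at_bot_linorderI[of "B - 1"]) force
qed

lemma exp_has_integral:
  fixes k :: int
  shows "((\<lambda>\<mu>. exp (\<i> * complex_of_real \<mu> * of_int k)) has_integral (if k = 0 then complex_of_real (2 * pi) else 0)) {-pi..pi}"
proof (cases "k = 0")
  case True
  then show ?thesis
    using has_integral_const_real[of "1::complex" "-pi" pi] by (simp add: scaleR_conv_of_real)
next
  case False
  define F where "F \<mu> = exp (\<i> * complex_of_real \<mu> * of_int k) / (\<i> * of_int k)" for \<mu>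
  have "((\<lambda>\<mu>. exp (\<i> * complex_of_real \<mu> * of_int k)) has_integral F pi - F (-pi)) {-pi..pi}"
    unfolding F_def using False
    by (intro fundamental_theorem_of_calculus)
       (auto intro!: derivative_eq_intros has_vector_derivative_real_field)
  moreover have "exp (\<i> * complex_of_real pi * of_int k) = exp (\<i> * complex_of_real (-pi) * of_int k)"
    unfolding exp_eq by (intro exI[of _ k]) (auto simp: algebra_simps)
  ultimately show ?thesis using False by (simp add: F_def)
qed

lemma exp_i_mult_cnj [simp]: "cnj (exp (\<i> * complex_of_real \<mu> * of_int n)) = exp (- (\<i> * complex_of_real \<mu> * of_int n))"
  by (simp add: exp_cnj)

lemma integrable_bounded_interval:
  fixes f :: "real \<Rightarrow> complex"
  assumes [measurable]: "f \<in> borel_measurable borel" and "bounded (f ` {a..b})"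
  shows "set_integrable lborel {a..b} f"
proof -
  obtain B where B: "\<And>x. x \<in> {a..b} \<Longrightarrow> norm (f x) \<le> B"
    using assms(2) unfolding bounded_iff by fastforce
  have "integrable (restrict_space lborel {a..b}) f"
  proof (rule finite_measure.integrable_const_bound[where B = B])
    show "finite_measure (restrict_space lborel {a..b})"
      by (intro finite_measureI)
        (use emeasure_lborel_cbox_finite[of a b] in \<open>auto simp: emeasure_restrict_space space_restrict_space\<close>)
    show "AE x in restrict_space lborel {a..b}. norm (f x) \<le> B"
      by (auto simp: AE_restrict_space_iff B)
  qed (auto intro!: measurable_restrict_space1)
  then show ?thesis
    by (simp add: set_integrable_eq)
qed


lemma fourier_coeff_restrict_space:
  fixes f :: "real \<Rightarrow> complex"
  assumes "f \<in> borel_measurable borel" and "bounded (f ` {-pi..pi})"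
  shows "fourier_coeff f n = complex_of_real (1 / (2 * pi)) *
    (\<integral>\<mu>. f \<mu> * cnj (exp (\<i> * complex_of_real \<mu> * of_int n)) \<partial>restrict_space lborel {-pi..pi})"
proof -
  define g where "g \<mu> = f \<mu> * exp (- (\<i> * complex_of_real \<mu> * of_int n))" for \<mu>
  have "set_integrable lborel {-pi..pi} g"
  proof (rule integrable_bounded_interval)
    show "g \<in> borel_measurable borel"
      unfolding g_def using assms(1) by measurable
    show "bounded (g ` {-pi..pi})"
      using assms(2) by (auto simp: g_def bounded_iff norm_mult)
  qed
  from set_borel_integral_eq_integral(2)[OF this]
  show ?thesis
    by (simp add: fourier_coeff_def g_def[abs_def] set_lebesgue_integral_def integral_restrict_space)
qed

text \<open>A bounded function is square integrable on \<open>[-\<pi>, \<pi>]\<close>, so Bessel's inequality for the exponentials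
  bounds the sums of the squared coefficients.\<close>

lemma riemann_lebesgue:
  fixes f :: "real \<Rightarrow> complex"
  assumes f: "f \<in> borel_measurable borel" and "bounded (f ` {-pi..pi})"
  shows "(fourier_coeff f \<longlongrightarrow> 0) cofinite"
proof -
  define R where "R = restrict_space lborel {-pi..pi}"
  define e where "e n \<mu> = exp (\<i> * complex_of_real \<mu> * of_int n)" for n :: int and \<mu> :: real
  have integrable_R: "integrable R g" if "g \<in> borel_measurable borel" "bounded (g ` {-pi..pi})"
    for g :: "real \<Rightarrow> complex"
    using integrable_bounded_interval[OF that] by (simp add: R_def set_integrable_eq)
  have meas: "e n \<in> borel_measurable borel" for n
    unfolding e_def by measurable
  have norm_e: "cmod (e n \<mu>) = 1" for n \<mu>
    by (simp add: e_def)
  obtain B where B: "\<And>x. x \<in> {-pi..pi} \<Longrightarrow> cmod (f x) \<le> B"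
    using assms(2) unfolding bounded_iff by fastforce
  have orth: "(\<integral>\<mu>. e i \<mu> * cnj (e j \<mu>) \<partial>R) = (if i = j then complex_of_real (2 * pi) else 0)" for i j
  proof -
    have *: "e i \<mu> * cnj (e j \<mu>) = e (i - j) \<mu>" for \<mu>
      by (simp add: e_def exp_cnj exp_add[symmetric]) (simp add: algebra_simps)
    have "set_integrable lborel {-pi..pi} (e (i - j))"
      using meas norm_e by (intro integrable_bounded_interval) (auto simp: bounded_iff intro: exI[of _ 1])
    from set_borel_integral_eq_integral(2)[OF this]
    have "(\<integral>\<mu>. e (i - j) \<mu> \<partial>R) = integral {-pi..pi} (e (i - j))"
      by (simp add: R_def set_lebesgue_integral_def integral_restrict_space)
    then show ?thesis
      using integral_unique[OF exp_has_integral[of "i - j"]] unfolding * by (simp add: e_def[abs_def])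
  qed
  have "((\<lambda>n. \<integral>\<mu>. f \<mu> * cnj (e n \<mu>) \<partial>R) \<longlongrightarrow> 0) cofinite"
  proof (rule square_bounded_sums_tendsto_0)
    fix F :: "int set" assume "finite F"
    then show "(\<Sum>n\<in>F. (cmod (\<integral>\<mu>. f \<mu> * cnj (e n \<mu>) \<partial>R))\<^sup>2) \<le> 2 * pi * Re (\<integral>\<mu>. f \<mu> * cnj (f \<mu>) \<partial>R)"
    proof (rule bessel_inequality)
      have "bounded ((\<lambda>\<mu>. f \<mu> * cnj (f \<mu>)) ` {-pi..pi})"
        using B by (auto simp: bounded_iff norm_mult intro!: exI[of _ "B * B"] mult_mono order_trans[OF norm_ge_zero B])
      then show "integrable R (\<lambda>\<mu>. f \<mu> * cnj (f \<mu>))"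
        by (intro integrable_R borel_measurable_times borel_measurable_cnj f)
      show "integrable R (\<lambda>\<mu>. f \<mu> * cnj (e i \<mu>))" for i
        using B
        by (intro integrable_R borel_measurable_times borel_measurable_cnj f meas)
           (auto simp: bounded_iff norm_mult norm_e intro!: exI[of _ B])
      show "integrable R (\<lambda>\<mu>. e i \<mu> * cnj (e j \<mu>))" for i j
        by (intro integrable_R borel_measurable_times borel_measurable_cnj meas)
           (auto simp: bounded_iff norm_mult norm_e)
    qed (use orth in auto)
  qed
  from tendsto_mult_left[OF this, of "complex_of_real (1 / (2 * pi))"] show ?thesis
    unfolding fourier_coeff_restrict_space[OF assms] by (simp add: e_def R_def)
qed

section \<open>Pointwise convergence of the Fourier series of a Lipschitz function\<close>

lemma sum_int_telescope:
  fixes T :: "int \<Rightarrow> 'b :: ab_group_add"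
  shows "(\<Sum>n = - int N..int N. T (n - 1) - T n) = T (- int N - 1) - T (int N)"
proof (induction N)
  case (Suc N)
  have "{- int (Suc N)..int (Suc N)} = insert (- int (Suc N)) (insert (int (Suc N)) {- int N..int N})"
    by auto
  then have "(\<Sum>n = - int (Suc N)..int (Suc N). T (n - 1) - T n) =
      (T (- int (Suc N) - 1) - T (- int (Suc N))) + ((T (int (Suc N) - 1) - T (int (Suc N))) +
        (\<Sum>n = - int N..int N. T (n - 1) - T n))"
    by simp
  also have "\<dots> = T (- int (Suc N) - 1) - T (int (Suc N))"
  proof -
    have eqs: "int (Suc N) - 1 = int N" "- int N - 1 = - int (Suc N)" by simp_all
    have cancel: "(a - b) + ((c - d) + (b - c)) = a - d" for a b c d :: 'b by simp
    show ?thesis unfolding Suc.IH eqs by (rule cancel)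
  qed
  finally show ?case .
qed simp

text \<open>Chernoff's form of the Dirichlet--Dini test. The hypothesis says that the quotient of \<open>f - L\<close> by
  \<open>exp (\<i> (\<mu> - \<mu>\<^sub>0)) - 1\<close> is bounded, and the coefficients of this quotient tend to \<open>0\<close>. For \<open>\<mu>\<^sub>0 = \<plusminus>\<pi>\<close>
  the exponential factor vanishes at both ends of \<open>[-\<pi>, \<pi>]\<close>, so the hypothesis then forces \<open>f\<close> to
  take the value \<open>L\<close> at both.\<close>

lemma fourier_partial_sum_tendsto:
  fixes f :: "real \<Rightarrow> complex"
  assumes f: "f \<in> borel_measurable borel"
    and chord: "\<And>\<mu>. \<mu> \<in> {-pi..pi} \<Longrightarrow>
      cmod (f \<mu> - L) \<le> K * cmod (exp (\<i> * complex_of_real (\<mu> - \<mu>\<^sub>0)) - 1)"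
  shows "fourier_partial_sum (fourier_coeff f) \<mu>\<^sub>0 \<longlonglongrightarrow> L"
proof -
  define w where "w \<mu> = exp (\<i> * complex_of_real (\<mu> - \<mu>\<^sub>0)) - 1" for \<mu>
  \<comment> \<open>At the zeros of \<open>w\<close>, division by zero gives \<open>g \<mu> = 0\<close>; there \<open>f \<mu> = L\<close>, so \<open>f = L + g * w\<close> survives.\<close>
  define g where "g \<mu> = (f \<mu> - L) / w \<mu>" for \<mu>
  define T where "T n = fourier_coeff g n * exp (\<i> * complex_of_real \<mu>\<^sub>0 * of_int n)" for n
  have g: "g \<in> borel_measurable borel"
    unfolding g_def w_def using f by measurable
  have g_le: "cmod (g \<mu>) \<le> \<bar>K\<bar>" if "\<mu> \<in> {-pi..pi}" for \<mu>
  proof (cases "w \<mu> = 0")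
    case False
    then show ?thesis
      using order_trans[OF chord[OF that] mult_right_mono[OF abs_ge_self norm_ge_zero]]
      by (simp only: g_def norm_divide w_def[symmetric]) (simp add: divide_simps)
  qed (simp add: g_def)
  then have bdd: "bounded (g ` {-pi..pi})"
    unfolding bounded_iff by blast
  have f_eq: "f \<mu> = L + g \<mu> * w \<mu>" if "\<mu> \<in> {-pi..pi}" for \<mu>
    using chord[OF that] by (cases "w \<mu> = 0") (auto simp: g_def simp flip: w_def simp del: of_real_diff)
  define E where "E n \<mu> = exp (\<i> * complex_of_real \<mu> * of_int n)" for n :: int and \<mu> :: real
  have Em: "exp (- (\<i> * complex_of_real \<mu> * of_int n)) = E (-n) \<mu>" for n \<mu>
    by (simp add: E_def)
  have int_g: "((\<lambda>\<mu>. g \<mu> * E (-n) \<mu>) has_integral 2 * pi * fourier_coeff g n) {-pi..pi}" for n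
  proof -
    have "set_integrable lborel {-pi..pi} (\<lambda>\<mu>. g \<mu> * E (-n) \<mu>)"
      using g g_le unfolding E_def
      by (intro integrable_bounded_interval) (auto simp: bounded_iff norm_mult intro!: exI[of _ "\<bar>K\<bar>"])
    then have "(\<lambda>\<mu>. g \<mu> * E (-n) \<mu>) integrable_on {-pi..pi}"
      by (rule set_borel_integral_eq_integral(1))
    then show ?thesis
      by (simp add: fourier_coeff_def Em has_integral_integral)
  qed
  \<comment> \<open>Multiplication of \<open>g\<close> by \<open>exp (\<i> \<mu>)\<close> shifts its coefficients by one, so \<open>w\<close> produces differences.\<close>
  have coeff: "fourier_coeff f n * E n \<mu>\<^sub>0 = (if n = 0 then L else 0) + (T (n - 1) - T n)" for n
  proof -
    have "((\<lambda>\<mu>. L * E (-n) \<mu> + (E (-1) \<mu>\<^sub>0 * (g \<mu> * E (-(n - 1)) \<mu>) - g \<mu> * E (-n) \<mu>)) has_integral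
        L * (if n = 0 then complex_of_real (2 * pi) else 0) +
        (E (-1) \<mu>\<^sub>0 * (2 * pi * fourier_coeff g (n - 1)) - 2 * pi * fourier_coeff g n)) {-pi..pi}"
      using exp_has_integral[of "-n"]
      by (intro has_integral_add has_integral_diff has_integral_mult_right int_g)
        (simp add: E_def)
    also have "?this \<longleftrightarrow> ((\<lambda>\<mu>. f \<mu> * E (-n) \<mu>) has_integral
        L * (if n = 0 then complex_of_real (2 * pi) else 0) +
        (E (-1) \<mu>\<^sub>0 * (2 * pi * fourier_coeff g (n - 1)) - 2 * pi * fourier_coeff g n)) {-pi..pi}"
      by (intro has_integral_cong)
        (simp add: f_eq E_def w_def ring_distribs exp_diff exp_minus field_simps)
    finally have "fourier_coeff f n = (if n = 0 then L else 0) + E (-1) \<mu>\<^sub>0 * fourier_coeff g (n - 1) - fourier_coeff g n"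
      unfolding fourier_coeff_def[of f] Em by (subst integral_unique, assumption) (simp add: field_simps)
    then show ?thesis
      by (auto simp: T_def E_def[symmetric] ring_distribs)
         (auto simp: E_def exp_diff exp_minus field_simps)
  qed
  have T_lim: "(T \<longlongrightarrow> 0) cofinite"
  proof (rule Lim_null_comparison)
    show "\<forall>\<^sub>F n in cofinite. cmod (T n) \<le> cmod (fourier_coeff g n)"
      by (simp add: T_def norm_mult)
    show "((\<lambda>n. cmod (fourier_coeff g n)) \<longlongrightarrow> 0) cofinite"
      using tendsto_norm[OF riemann_lebesgue[OF g bdd]] by simp
  qed
  have "filterlim (\<lambda>N. - int N - 1) at_bot sequentially"
    unfolding filterlim_at_bot
  proof
    fix Z :: int
    show "\<forall>\<^sub>F N in sequentially. - int N - 1 \<le> Z"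
      by (rule eventually_sequentiallyI[of "nat \<bar>Z\<bar>"]) linarith
  qed
  from filterlim_compose[OF tendsto_mono[OF int_at_bot_le_cofinite T_lim] this]
    filterlim_compose[OF tendsto_mono[OF int_at_top_le_cofinite T_lim] filterlim_int_sequentially]
  have "(\<lambda>N. T (- int N - 1) - T (int N)) \<longlonglongrightarrow> 0 - 0"
    by (rule tendsto_diff)
  then have "(\<lambda>N. L + (T (- int N - 1) - T (int N))) \<longlonglongrightarrow> L"
    using tendsto_add[OF tendsto_const[of L]] by fastforce
  moreover have "fourier_partial_sum (fourier_coeff f) \<mu>\<^sub>0 N = L + (T (- int N - 1) - T (int N))" for N
    unfolding fourier_partial_sum_def E_def[symmetric] coeff sum.distrib sum_int_telescope
    by (simp add: sum.delta)
  ultimately show ?thesis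
    by presburger
qed


text \<open>A chord of the unit circle is at least \<open>2 / \<pi>\<close> times its arc, up to a half circle, by concavity of the sine on
  \<open>[0, \<pi> / 2]\<close> (Jordan's inequality). This turns Lipschitz bounds into the bounds by
  \<open>\<bar>exp (\<i> (\<mu> - \<mu>\<^sub>0)) - 1\<bar>\<close> needed for Chernoff's argument.\<close>

lemma norm_exp_i_minus_1_ge:
  assumes "\<bar>x\<bar> \<le> pi"
  shows "2 / pi * \<bar>x\<bar> \<le> cmod (exp (\<i> * complex_of_real x) - 1)"
proof -
  define s where "s = \<bar>x\<bar> / pi"
  have s: "0 \<le> s" "s \<le> 1"
    using assms by (auto simp: s_def)
  have "convex_on {0..pi/2} (\<lambda>t. - sin t)"
    by (rule f''_ge0_imp_convex[where f' = "\<lambda>t. - cos t" and f'' = sin])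
       (auto intro!: derivative_eq_intros sin_ge_zero)
  from convex_onD[OF this, of s 0 "pi / 2"] have "s \<le> sin (s * (pi / 2))"
    using s by simp
  also have "s * (pi / 2) = \<bar>x\<bar> / 2"
    by (simp add: s_def)
  also have "sin (\<bar>x\<bar> / 2) \<le> \<bar>sin (x / 2)\<bar>"
    by (cases "x \<ge> 0") auto
  finally show ?thesis
    unfolding dist_exp_i_1 by (simp add: s_def)
qed

text \<open>On the interval, \<open>\<mu> - \<mu>\<^sub>0\<close> stays at distance at least \<open>\<eta> = \<pi> - \<bar>\<mu>\<^sub>0\<bar>\<close> from \<open>\<plusminus>2 \<pi>\<close>. Hence the chord from
  \<open>1\<close> to \<open>exp (\<i> (\<mu> - \<mu>\<^sub>0))\<close> vanishes only at \<open>\<mu> = \<mu>\<^sub>0\<close> and dominates a multiple of \<open>\<bar>\<mu> - \<mu>\<^sub>0\<bar>\<close>.\<close>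

lemma fourier_partial_sum_tendsto_interior:
  fixes f :: "real \<Rightarrow> complex"
  assumes f: "f \<in> borel_measurable borel" and lip: "K-lipschitz_on {-pi..pi} f"
    and \<mu>\<^sub>0: "\<mu>\<^sub>0 \<in> {-pi<..<pi}"
  shows "fourier_partial_sum (fourier_coeff f) \<mu>\<^sub>0 \<longlonglongrightarrow> f \<mu>\<^sub>0"
proof (rule fourier_partial_sum_tendsto[OF f])
  define \<eta> where "\<eta> = pi - \<bar>\<mu>\<^sub>0\<bar>"
  have \<eta>: "0 < \<eta>" "\<eta> \<le> pi"
    using \<mu>\<^sub>0 by (auto simp: \<eta>_def)
  fix \<mu> assume \<mu>: "\<mu> \<in> {-pi..pi}"
  define x where "x = \<mu> - \<mu>\<^sub>0"
  have x_le: "\<bar>x\<bar> \<le> 2 * pi - \<eta>"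
    using \<mu> \<mu>\<^sub>0 by (auto simp: x_def \<eta>_def)
  have "\<eta> / pi\<^sup>2 * \<bar>x\<bar> \<le> cmod (exp (\<i> * complex_of_real x) - 1)"
  proof (cases "\<bar>x\<bar> \<le> pi")
    case True
    have "\<eta> / pi\<^sup>2 * \<bar>x\<bar> \<le> pi / pi\<^sup>2 * \<bar>x\<bar>"
      using \<eta> by (intro mult_right_mono divide_right_mono) auto
    also have "\<dots> \<le> 2 / pi * \<bar>x\<bar>"
      by (simp add: power2_eq_square divide_right_mono)
    also have "\<dots> \<le> cmod (exp (\<i> * complex_of_real x) - 1)"
      using True by (rule norm_exp_i_minus_1_ge)
    finally show ?thesis .
  next
    case False
    \<comment> \<open>The representative of \<open>x\<close> modulo \<open>2 \<pi>\<close> in \<open>[-\<pi>, \<pi>]\<close>, where the chord bound applies.\<close>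
    define y where "y = x - sgn x * (2 * pi)"
    have y: "\<bar>y\<bar> = 2 * pi - \<bar>x\<bar>"
      using False x_le \<eta> by (auto simp: y_def sgn_if abs_if)
    have "\<eta> / pi\<^sup>2 * \<bar>x\<bar> \<le> \<eta> / pi\<^sup>2 * (2 * pi)"
      using x_le \<eta> by (intro mult_left_mono) auto
    also have "\<dots> = 2 / pi * \<eta>"
      by (simp add: power2_eq_square)
    also have "\<dots> \<le> 2 / pi * \<bar>y\<bar>"
      using x_le y by (intro mult_left_mono) auto
    also have "\<dots> \<le> cmod (exp (\<i> * complex_of_real y) - 1)"
      using False y by (intro norm_exp_i_minus_1_ge) auto
    also have "exp (\<i> * complex_of_real y) = exp (\<i> * complex_of_real x)"
      unfolding exp_eq
      using False by (intro exI[of _ "if x > 0 then -1 else 1"]) (auto simp: y_def sgn_if algebra_simps)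
    finally show ?thesis .
  qed
  then have *: "\<bar>x\<bar> \<le> pi\<^sup>2 / \<eta> * cmod (exp (\<i> * complex_of_real x) - 1)"
    using \<eta> by (simp add: field_simps)
  have "cmod (f \<mu> - f \<mu>\<^sub>0) \<le> K * \<bar>x\<bar>"
    using lipschitz_onD[OF lip \<mu>, of \<mu>\<^sub>0] \<mu>\<^sub>0 by (auto simp: dist_norm x_def)
  also have "\<dots> \<le> K * (pi\<^sup>2 / \<eta> * cmod (exp (\<i> * complex_of_real x) - 1))"
    using * lipschitz_on_nonneg[OF lip] by (rule mult_left_mono)
  finally show "cmod (f \<mu> - f \<mu>\<^sub>0) \<le> (K * (pi\<^sup>2 / \<eta>)) * cmod (exp (\<i> * complex_of_real (\<mu> - \<mu>\<^sub>0)) - 1)"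
    by (simp add: x_def mult.assoc)
qed

text \<open>At \<open>\<plusminus>\<pi>\<close> the terms \<open>exp (\<i> \<mu>\<^sub>0 n)\<close> are even in \<open>n\<close>, so the symmetric sums do not change when \<open>f\<close> is
  replaced by its even part \<open>h\<close>. A possible jump disappears: \<open>h\<close> takes the average of \<open>f (-\<pi>)\<close> and
  \<open>f \<pi>\<close> at both ends, and Chernoff's argument applies to it.\<close>

lemma fourier_partial_sum_tendsto_endpoint:
  fixes f :: "real \<Rightarrow> complex"
  assumes f: "continuous_on UNIV f" and lip: "K-lipschitz_on {-pi..pi} f"
    and \<mu>\<^sub>0: "\<mu>\<^sub>0 \<in> {-pi, pi}"
  shows "fourier_partial_sum (fourier_coeff f) \<mu>\<^sub>0 \<longlonglongrightarrow> (f (-pi) + f pi) / 2"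
proof -
  define h where "h \<mu> = 1 / 2 * (f \<mu> + f (- \<mu>))" for \<mu>
  have cont: "continuous_on S f" "continuous_on S (\<lambda>\<mu>. f (- \<mu>))" for S
    by (rule continuous_on_subset[OF f], simp)
       (rule continuous_on_compose2[OF f], auto intro: continuous_intros)
  have coeff: "fourier_coeff h n = 1 / 2 * (fourier_coeff f n + fourier_coeff f (- n))" for n
    unfolding h_def fourier_coeff_cmult
    by (subst fourier_coeff_add) (auto simp: cont fourier_coeff_reflect)
  have "exp (\<i> * complex_of_real \<mu>\<^sub>0 * of_int (- n)) = exp (\<i> * complex_of_real \<mu>\<^sub>0 * of_int n)" for n
    unfolding exp_eq using \<mu>\<^sub>0
    by (intro exI[of _ "if \<mu>\<^sub>0 = pi then -n else n"]) (auto simp: algebra_simps)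
  then have even: "exp (- (\<i> * complex_of_real \<mu>\<^sub>0 * of_int n)) = exp (\<i> * complex_of_real \<mu>\<^sub>0 * of_int n)" for n
    by simp
  have sums: "fourier_partial_sum (fourier_coeff h) \<mu>\<^sub>0 N = fourier_partial_sum (fourier_coeff f) \<mu>\<^sub>0 N" for N
  proof -
    have "(\<Sum>n = - int N..int N. fourier_coeff f (- n) * exp (\<i> * complex_of_real \<mu>\<^sub>0 * of_int n))
        = (\<Sum>n = - int N..int N. fourier_coeff f n * exp (\<i> * complex_of_real \<mu>\<^sub>0 * of_int n))"
      by (rule sum.reindex_bij_witness[of _ uminus uminus]) (auto simp: even)
    then show ?thesis
      by (simp add: fourier_partial_sum_def coeff ring_distribs sum.distrib sum_divide_distrib[symmetric])
  qed
  have "fourier_partial_sum (fourier_coeff h) \<mu>\<^sub>0 \<longlonglongrightarrow> h pi"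
  proof (rule fourier_partial_sum_tendsto)
    show "h \<in> borel_measurable borel"
      unfolding h_def by (intro borel_measurable_continuous_onI continuous_intros cont)
    fix \<mu> assume \<mu>: "\<mu> \<in> {-pi..pi}"
    \<comment> \<open>The distance from \<open>\<mu>\<close> to the nearer endpoint.\<close>
    define x where "x = pi - \<bar>\<mu>\<bar>"
    have K: "0 \<le> K" using lip by (rule lipschitz_on_nonneg)
    have "cmod (f \<mu> + f (- \<mu>) - (f pi + f (- pi))) \<le> K * x + K * x"
    proof (cases "\<mu> \<ge> 0")
      case True
      have "cmod ((f \<mu> - f pi) + (f (- \<mu>) - f (- pi))) \<le> K * x + K * x"
        using \<mu> True lipschitz_onD[OF lip, of \<mu> pi] lipschitz_onD[OF lip, of "-\<mu>" "-pi"]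
        by (intro norm_triangle_mono) (auto simp: dist_norm x_def add.commute)
      then show ?thesis by (simp add: algebra_simps)
    next
      case False
      have "cmod ((f \<mu> - f (- pi)) + (f (- \<mu>) - f pi)) \<le> K * x + K * x"
        using \<mu> False lipschitz_onD[OF lip, of \<mu> "-pi"] lipschitz_onD[OF lip, of "-\<mu>" pi]
        by (intro norm_triangle_mono) (auto simp: dist_norm x_def add.commute)
      then show ?thesis by (simp add: algebra_simps)
    qed
    moreover have "h \<mu> - h pi = 1 / 2 * (f \<mu> + f (- \<mu>) - (f pi + f (- pi)))"
      by (simp add: h_def algebra_simps)
    ultimately have "cmod (h \<mu> - h pi) \<le> K * x"
      by (simp only: norm_mult) simp
    also have "\<dots> \<le> K * (pi / 2 * cmod (exp (\<i> * complex_of_real (\<mu> - \<mu>\<^sub>0)) - 1))"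
    proof (rule mult_left_mono[OF _ K])
      define y where "y = (if \<mu> \<ge> 0 then \<mu> - pi else \<mu> + pi)"
      have "2 / pi * \<bar>y\<bar> \<le> cmod (exp (\<i> * complex_of_real y) - 1)"
        using \<mu> by (intro norm_exp_i_minus_1_ge) (auto simp: y_def)
      also have "\<bar>y\<bar> = x"
        using \<mu> by (auto simp: y_def x_def)
      also have "exp (\<i> * complex_of_real y) = exp (\<i> * complex_of_real (\<mu> - \<mu>\<^sub>0))"
        unfolding exp_eq using \<mu>\<^sub>0
        by (intro exI[of _ "(if \<mu> \<ge> 0 then if \<mu>\<^sub>0 = pi then 0 else -1 else if \<mu>\<^sub>0 = pi then 1 else 0)"])
           (auto simp: y_def algebra_simps)
      finally show "x \<le> pi / 2 * cmod (exp (\<i> * complex_of_real (\<mu> - \<mu>\<^sub>0)) - 1)"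
        by (simp add: field_simps)
    qed
    finally show "cmod (h \<mu> - h pi) \<le> (K * (pi / 2)) * cmod (exp (\<i> * complex_of_real (\<mu> - \<mu>\<^sub>0)) - 1)"
      by (simp add: mult.assoc)
  qed
  then show ?thesis
    unfolding sums by (simp add: h_def add.commute)
qed

section \<open>Decay of the Fourier coefficients of a Lipschitz function\<close>

text \<open>A shift by \<open>h = \<pi> / n\<close> flips the sign of the exponential. So twice the coefficient is the integral of
  \<open>f \<mu> - f (h + \<mu>)\<close> against the exponential, which is \<open>O(h)\<close> by the Lipschitz condition, up to the
  integrals over the two intervals of length \<open>h\<close> where \<open>[-\<pi>, \<pi>]\<close> and its shift do not overlap. The
  interval \<open>[-\<pi>, 2 \<pi>]\<close> contains all shifted points, as \<open>h \<le> \<pi>\<close>.\<close>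

lemma fourier_coeff_norm_le:
  fixes f :: "real \<Rightarrow> complex"
  assumes cont: "continuous_on UNIV f" and lip: "K-lipschitz_on {-pi..2 * pi} f"
    and B: "\<And>\<mu>. \<mu> \<in> {-pi..2 * pi} \<Longrightarrow> cmod (f \<mu>) \<le> B" and "n > 0"
  shows "cmod (fourier_coeff f n) \<le> (pi * K + B) / (2 * of_int n)"
proof -
  define h where "h = pi / of_int n"
  have h: "0 < h" "h \<le> pi"
    using \<open>n > 0\<close> by (auto simp: h_def field_simps)
  define E where "E \<mu> = exp (- (\<i> * complex_of_real \<mu> * of_int n))" for \<mu>
  define F where "F \<mu> = f \<mu> * E \<mu>" for \<mu>
  have contf: "continuous_on S f" for S
    by (rule continuous_on_subset[OF cont]) simp
  have contE: "continuous_on S E" for S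
    unfolding E_def by (intro continuous_intros)
  have contF: "continuous_on S F" for S
    unfolding F_def by (intro continuous_intros contf contE)
  have intF: "F integrable_on {a..b}" for a b
    by (intro integrable_continuous_real contF)
  have normE: "cmod (E \<mu>) = 1" for \<mu>
    by (simp add: E_def norm_exp_eq_Re)
  have E_shift: "E (h + \<mu>) = - E \<mu>" for \<mu>
  proof -
    have "E (h + \<mu>) = E \<mu> * exp (- (\<i> * complex_of_real pi))"
      using \<open>n > 0\<close> by (simp add: E_def h_def exp_add[symmetric] algebra_simps)
    also have "exp (- (\<i> * complex_of_real pi)) = -1"
      by (simp add: exp_minus exp_pi_i')
    finally show ?thesis by simp
  qed
  define I where "I = integral {-pi..pi} F"
  have split1: "integral {-pi..-pi + h} F + integral {-pi + h..pi} F = I"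
    unfolding I_def using h by (intro Henstock_Kurzweil_Integration.integral_combine intF) auto
  have split2: "integral {-pi + h..pi} F + integral {pi..pi + h} F = integral {-pi + h..pi + h} F"
    using h by (intro Henstock_Kurzweil_Integration.integral_combine intF) auto
  have "integral {-pi + h..pi + h} F = integral {-pi..pi} (F \<circ> ((+) h))"
    by (rule integral_shift_Icc_real[symmetric])
  also have "\<dots> = integral {-pi..pi} (\<lambda>\<mu>. - (f (h + \<mu>) * E \<mu>))"
    by (simp add: F_def E_shift comp_def)
  finally have "I + integral {-pi + h..pi + h} F = integral {-pi..pi} (\<lambda>\<mu>. F \<mu> + - (f (h + \<mu>) * E \<mu>))"
    unfolding I_def
    by (simp only:) (intro Henstock_Kurzweil_Integration.integral_add[symmetric] intF
        integrable_continuous_real continuous_intros contE continuous_on_compose2[OF cont], auto)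
  also have "\<dots> = integral {-pi..pi} (\<lambda>\<mu>. (f \<mu> - f (h + \<mu>)) * E \<mu>)"
    by (simp add: F_def algebra_simps)
  finally have overlap: "I + integral {-pi + h..pi + h} F = integral {-pi..pi} (\<lambda>\<mu>. (f \<mu> - f (h + \<mu>)) * E \<mu>)" .
  have solve: "2 * i = x + (p - q)" if "i + s = x" "p + m = i" "m + q = s" for i s x p m q :: complex
    unfolding that(1)[symmetric] that(2,3)[symmetric] by (simp add: algebra_simps)
  have eq: "2 * I = integral {-pi..pi} (\<lambda>\<mu>. (f \<mu> - f (h + \<mu>)) * E \<mu>)
      + (integral {-pi..-pi + h} F - integral {pi..pi + h} F)"
    by (rule solve[OF overlap split1 split2])
  have 1: "cmod (integral {-pi..pi} (\<lambda>\<mu>. (f \<mu> - f (h + \<mu>)) * E \<mu>)) \<le> K * h * (pi - (-pi))"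
  proof (rule integral_bound)
    show "continuous_on {-pi..pi} (\<lambda>\<mu>. (f \<mu> - f (h + \<mu>)) * E \<mu>)"
      by (intro continuous_intros contE contf continuous_on_compose2[OF cont]) auto
    fix \<mu> assume "\<mu> \<in> {-pi..pi}"
    then show "cmod ((f \<mu> - f (h + \<mu>)) * E \<mu>) \<le> K * h"
      using lipschitz_onD[OF lip, of \<mu> "h + \<mu>"] h by (auto simp: norm_mult normE dist_norm)
  qed simp
  have 2: "cmod (integral {-pi..-pi + h} F) \<le> B * ((-pi + h) - (-pi))"
    using h by (intro integral_bound contF) (auto simp: F_def norm_mult normE intro!: B)
  have 3: "cmod (integral {pi..pi + h} F) \<le> B * ((pi + h) - pi)"
    using h by (intro integral_bound contF) (auto simp: F_def norm_mult normE intro!: B)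
  have "2 * cmod I = cmod (2 * I)"
    by (simp add: norm_mult)
  also have "\<dots> \<le> 2 * pi * K * h + (B * h + B * h)"
    unfolding eq using 1 2 3
    by (intro order_trans[OF norm_triangle_ineq] add_mono order_trans[OF norm_triangle_ineq4])
       (auto simp: algebra_simps)
  finally have "cmod I \<le> (pi * K + B) * h"
    by (simp add: algebra_simps)
  moreover have "fourier_coeff f n = complex_of_real (1 / (2 * pi)) * I"
    by (simp add: fourier_coeff_def I_def F_def[abs_def] E_def)
  ultimately have "cmod (fourier_coeff f n) \<le> 1 / (2 * pi) * ((pi * K + B) * h)"
    by (simp add: norm_mult norm_divide divide_right_mono)
  also have "\<dots> = (pi * K + B) / (2 * of_int n)"
    using \<open>n > 0\<close> by (simp add: h_def)
  finally show ?thesis .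
qed

text \<open>Negative indices reduce to positive ones by the reflection \<open>\<mu> \<mapsto> - \<mu>\<close>; this is why the Lipschitz
  condition is imposed on an interval symmetric about \<open>0\<close>.\<close>

lemma fourier_coeff_bigo:
  fixes f :: "real \<Rightarrow> complex"
  assumes cont: "continuous_on UNIV f" and lip: "K-lipschitz_on {-2 * pi..2 * pi} f"
  shows "fourier_coeff f \<in> O[at_top](\<lambda>n. 1 / of_int n)"
    and "fourier_coeff f \<in> O[at_bot](\<lambda>n. 1 / of_int n)"
proof -
  have "compact (f ` {-2 * pi..2 * pi})"
    by (intro compact_continuous_image continuous_on_subset[OF cont]) auto
  then obtain B where B: "\<And>\<mu>. \<mu> \<in> {-2 * pi..2 * pi} \<Longrightarrow> cmod (f \<mu>) \<le> B"
    using compact_imp_bounded[of "f ` {-2 * pi..2 * pi}"] unfolding bounded_iff by blast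
  define C where "C = (pi * K + B) / 2"
  have pos: "cmod (fourier_coeff f n) \<le> C / of_int n" if "n > 0" for n
    using fourier_coeff_norm_le[OF cont lipschitz_on_subset[OF lip] B that] by (auto simp: C_def)
  have neg: "cmod (fourier_coeff f (- n)) \<le> C / of_int n" if "n > 0" for n
  proof -
    have "K-lipschitz_on {-2 * pi..2 * pi} (\<lambda>\<mu>. f (- \<mu>))"
    proof (rule lipschitz_onI)
      fix x y :: real assume "x \<in> {-2 * pi..2 * pi}" "y \<in> {-2 * pi..2 * pi}"
      then show "dist (f (- x)) (f (- y)) \<le> K * dist x y"
        using lipschitz_onD[OF lip, of "-x" "-y"] by (auto simp: dist_minus)
    qed (rule lipschitz_on_nonneg[OF lip])
    then have "cmod (fourier_coeff (\<lambda>\<mu>. f (- \<mu>)) n) \<le> (pi * K + B) / (2 * of_int n)"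
      using that B
      by (intro fourier_coeff_norm_le continuous_on_compose2[OF cont])
         (auto intro: lipschitz_on_subset continuous_intros)
    then show ?thesis
      by (simp add: fourier_coeff_reflect C_def)
  qed
  show "fourier_coeff f \<in> O[at_top](\<lambda>n. 1 / of_int n)"
  proof (rule bigoI)
    show "\<forall>\<^sub>F n in at_top. norm (fourier_coeff f n) \<le> C * norm (1 / of_int n :: complex)"
      using eventually_gt_at_top[of "0::int"] by eventually_elim (use pos in \<open>simp add: norm_divide\<close>)
  qed
  show "fourier_coeff f \<in> O[at_bot](\<lambda>n. 1 / of_int n)"
  proof (rule bigoI)
    show "\<forall>\<^sub>F n in at_bot. norm (fourier_coeff f n) \<le> C * norm (1 / of_int n :: complex)"
      using eventually_le_at_bot[of "-1::int"]
    proof eventually_elim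
      case (elim n)
      then show ?case using neg[of "- n"] by (simp add: norm_divide)
    qed
  qed
qed


section \<open>The continuous logarithm of the characteristic function\<close>

text \<open>The difference of two continuous logarithms takes values in \<open>2 \<pi> \<i> \<int>\<close>, a set with gaps of length
  \<open>2 \<pi>\<close>, and is therefore constant on the connected real line.\<close>

lemma continuous_logarithm_unique:
  fixes f g :: "real \<Rightarrow> complex"
  assumes "continuous_on UNIV f" "continuous_on UNIV g" "f 0 = g 0"
    and exp_eq': "\<And>x. exp (f x) = exp (g x)"
  shows "f = g"
proof -
  define d where "d x = f x - g x" for x
  have d: "\<exists>n::int. d x = complex_of_real (of_int (2 * n) * pi) * \<i>" for x
    using exp_eq'[of x] unfolding exp_eq by (auto simp: d_def)
  have "d constant_on UNIV"
  proof (rule continuous_discrete_range_constant)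
    show "continuous_on UNIV d"
      unfolding d_def using assms by (intro continuous_intros)
    fix x
    have "2 * pi \<le> norm (d y - d x)" if "d y \<noteq> d x" for y
    proof -
      obtain m n :: int where mn: "d x = complex_of_real (of_int (2 * m) * pi) * \<i>"
          "d y = complex_of_real (of_int (2 * n) * pi) * \<i>"
        using d by metis
      then have "n \<noteq> m" using that by auto
      then have "1 \<le> \<bar>real_of_int (n - m)\<bar>" by linarith
      then have "2 * pi * 1 \<le> 2 * pi * \<bar>real_of_int (n - m)\<bar>"
        by (intro mult_left_mono) auto
      also have "d y - d x = complex_of_real (2 * pi * of_int (n - m)) * \<i>"
        by (simp add: mn algebra_simps)
      then have "2 * pi * \<bar>real_of_int (n - m)\<bar> = norm (d y - d x)"
        by (simp add: norm_mult abs_mult del: of_int_diff of_real_mult)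
      finally show ?thesis by simp
    qed
    then show "\<exists>e>0. \<forall>y. y \<in> UNIV \<and> d y \<noteq> d x \<longrightarrow> e \<le> norm (d y - d x)"
      by (intro exI[of _ "2 * pi"]) auto
  qed auto
  then show ?thesis
    using \<open>f 0 = g 0\<close> by (auto simp: constant_on_def d_def fun_eq_iff)
      (metis diff_self eq_iff_diff_eq_0)
qed

text \<open>A competing phase, combined with the real part of \<open>g\<close>, would be a second continuous logarithm.\<close>

lemma unwrapped_phase_eq_Im:
  assumes cont: "continuous_on UNIV g" and "g 0 = 0" and \<Phi>: "\<And>\<mu>. \<Phi> \<mu> = exp (g \<mu>)"
  shows "unwrapped_phase \<Phi> = (\<lambda>\<mu>. Im (g \<mu>))"
  unfolding unwrapped_phase_def
proof (rule the_equality)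
  show "continuous_on UNIV (\<lambda>\<mu>. Im (g \<mu>)) \<and> Im (g 0) = 0 \<and>
      (\<forall>\<mu>. \<Phi> \<mu> = complex_of_real (cmod (\<Phi> \<mu>)) * cis (Im (g \<mu>)))"
    using cont \<open>g 0 = 0\<close> by (auto simp: \<Phi> exp_eq_polar norm_mult intro: continuous_intros)
next
  fix \<theta> assume \<theta>: "continuous_on UNIV \<theta> \<and> \<theta> 0 = 0 \<and>
      (\<forall>\<mu>. \<Phi> \<mu> = complex_of_real (cmod (\<Phi> \<mu>)) * cis (\<theta> \<mu>))"
  have "(\<lambda>\<mu>. complex_of_real (Re (g \<mu>)) + \<i> * complex_of_real (\<theta> \<mu>)) = g"
  proof (rule continuous_logarithm_unique)
    show "exp (complex_of_real (Re (g \<mu>)) + \<i> * complex_of_real (\<theta> \<mu>)) = exp (g \<mu>)" for \<mu>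
    proof -
      have "\<Phi> \<mu> = complex_of_real (cmod (\<Phi> \<mu>)) * cis (\<theta> \<mu>)" using \<theta> by blast
      then show ?thesis
        by (simp add: \<Phi> exp_add cis_conv_exp exp_of_real)
    qed
  qed (use \<theta> cont \<open>g 0 = 0\<close> in \<open>auto intro!: continuous_intros\<close>)
  then show "\<theta> = (\<lambda>\<mu>. Im (g \<mu>))"
    by (auto simp: fun_eq_iff complex_eq_iff)
qed

text \<open>This is how the symmetries of the characteristic function pass to its logarithm: it is enough to
  exhibit a continuous candidate that vanishes at \<open>0\<close> and exponentiates correctly.\<close>

lemma log_char_unique:
  assumes "continuous_on UNIV g" "g 0 = 0" and "\<And>\<mu>. char_fun M X \<mu> = exp (g \<mu>)"
  shows "log_char M X = g"
proof
  fix \<mu>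
  show "log_char M X \<mu> = g \<mu>"
    by (simp add: log_char_def unwrapped_phase_eq_Im[OF assms] assms(3) complex_eq_iff)
qed

lemma muculant_eq_fourier_coeff: "muculant M X = fourier_coeff (log_char M X)"
  by (simp add: muculant_def fourier_coeff_def fun_eq_iff)

context prob_space
begin

lemma real_distribution_distr_int:
  assumes [measurable]: "X \<in> measurable M (count_space (UNIV :: int set))"
  shows "real_distribution (distr M borel (\<lambda>\<omega>. real_of_int (X \<omega>)))"
  by (rule real_distribution_distr) measurable

lemma char_fun_eq:
  assumes [measurable]: "X \<in> measurable M (count_space (UNIV :: int set))"
  shows "char_fun M X \<mu> = (\<integral>\<omega>. iexp (\<mu> * of_int (X \<omega>)) \<partial>M)"
  unfolding char_fun_def char_def by (subst integral_distr) auto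

lemma integrable_iexp_int:
  assumes [measurable]: "X \<in> measurable M (count_space (UNIV :: int set))"
  shows "integrable M (\<lambda>\<omega>. iexp (\<mu> * of_int (X \<omega>)))"
  by (rule integrable_const_bound[of _ 1]) (auto simp del: of_real_mult)

lemma
  assumes X: "X \<in> measurable M (count_space (UNIV :: int set))"
  shows continuous_char_fun: "continuous_on UNIV (char_fun M X)"
    and char_fun_0: "char_fun M X 0 = 1"
    and cmod_char_fun_le_1: "cmod (char_fun M X \<mu>) \<le> 1"
  using real_distribution.isCont_char[OF real_distribution_distr_int[OF X]]
    real_distribution.char_zero[OF real_distribution_distr_int[OF X]]
    real_distribution.cmod_char_le_1[OF real_distribution_distr_int[OF X]]
  by (auto simp: char_fun_def continuous_on_eq_continuous_at)

lemma char_fun_minus: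
  assumes X: "X \<in> measurable M (count_space (UNIV :: int set))"
  shows "char_fun M X (- \<mu>) = cnj (char_fun M X \<mu>)"
  unfolding char_fun_eq[OF X] Bochner_Integration.integral_cnj[symmetric]
  by (simp add: exp_cnj)

text \<open>Integrate the pointwise estimate \<open>\<bar>exp (\<i> a) - exp (\<i> b)\<bar> \<le> \<bar>a - b\<bar>\<close>.\<close>

lemma char_fun_lipschitz:
  assumes X [measurable]: "X \<in> measurable M (count_space (UNIV :: int set))"
    and int: "integrable M (\<lambda>\<omega>. real_of_int (X \<omega>))"
  shows "cmod (char_fun M X \<mu> - char_fun M X \<nu>) \<le> expectation (\<lambda>\<omega>. \<bar>real_of_int (X \<omega>)\<bar>) * \<bar>\<mu> - \<nu>\<bar>"
proof -
  have iexp_diff: "cmod (iexp a - iexp b) \<le> \<bar>a - b\<bar>" for a b :: real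
  proof -
    have "iexp a - iexp b = iexp b * (iexp (a - b) - 1)"
      by (simp add: algebra_simps exp_add[symmetric])
    then have "cmod (iexp a - iexp b) = 2 * \<bar>sin ((a - b) / 2)\<bar>"
      by (simp only: norm_mult norm_exp_i_times dist_exp_i_1 mult_1)
    also have "\<dots> \<le> \<bar>a - b\<bar>"
      using abs_sin_x_le_abs_x[of "(a - b) / 2"] by simp
    finally show ?thesis .
  qed
  have "char_fun M X \<mu> - char_fun M X \<nu> = (\<integral>\<omega>. iexp (\<mu> * of_int (X \<omega>)) - iexp (\<nu> * of_int (X \<omega>)) \<partial>M)"
    unfolding char_fun_eq[OF X] by (intro Bochner_Integration.integral_diff[symmetric] integrable_iexp_int X)
  also have "cmod \<dots> \<le> (\<integral>\<omega>. cmod (iexp (\<mu> * of_int (X \<omega>)) - iexp (\<nu> * of_int (X \<omega>))) \<partial>M)"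
    by (rule integral_norm_bound)
  also have "\<dots> \<le> (\<integral>\<omega>. \<bar>real_of_int (X \<omega>)\<bar> * \<bar>\<mu> - \<nu>\<bar> \<partial>M)"
  proof (rule integral_mono)
    show "integrable M (\<lambda>\<omega>. cmod (iexp (\<mu> * of_int (X \<omega>)) - iexp (\<nu> * of_int (X \<omega>))))"
      by (intro integrable_norm Bochner_Integration.integrable_diff integrable_iexp_int X)
    show "integrable M (\<lambda>\<omega>. \<bar>real_of_int (X \<omega>)\<bar> * \<bar>\<mu> - \<nu>\<bar>)"
      using int by (intro integrable_mult_left integrable_abs)
    show "cmod (iexp (\<mu> * of_int (X \<omega>)) - iexp (\<nu> * of_int (X \<omega>))) \<le> \<bar>real_of_int (X \<omega>)\<bar> * \<bar>\<mu> - \<nu>\<bar>" for \<omega>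
      using iexp_diff[of "\<mu> * of_int (X \<omega>)" "\<nu> * of_int (X \<omega>)"]
      by (simp add: abs_mult[symmetric] algebra_simps)
  qed
  also have "\<dots> = expectation (\<lambda>\<omega>. \<bar>real_of_int (X \<omega>)\<bar>) * \<bar>\<mu> - \<nu>\<bar>"
    by simp
  finally show ?thesis .
qed

text \<open>The symmetry of the mass function says that \<open>X\<close> and \<open>- X\<close> have the same law.\<close>

lemma char_fun_even:
  assumes X [measurable]: "X \<in> measurable M (count_space (UNIV :: int set))"
    and sym: "\<And>\<xi>. prob_mass M X \<xi> = prob_mass M X (- \<xi>)"
  shows "char_fun M X (- \<mu>) = char_fun M X \<mu>"
proof -
  have eq: "distr M (count_space UNIV) X = distr M (count_space UNIV) (\<lambda>\<omega>. - X \<omega>)"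
  proof (rule measure_eqI_countable[of _ UNIV])
    fix \<xi> :: int
    have "emeasure (distr M (count_space UNIV) X) {\<xi>} = prob_mass M X \<xi>"
      by (subst emeasure_distr) (auto simp: emeasure_eq_measure prob_mass_def intro!: arg_cong[where f = "measure M"])
    also have "\<dots> = prob_mass M X (- \<xi>)"
      using sym by simp
    also have "\<dots> = emeasure (distr M (count_space UNIV) (\<lambda>\<omega>. - X \<omega>)) {\<xi>}"
      by (subst emeasure_distr) (auto simp: emeasure_eq_measure prob_mass_def intro!: arg_cong[where f = "measure M"])
    finally show "emeasure (distr M (count_space UNIV) X) {\<xi>} = emeasure (distr M (count_space UNIV) (\<lambda>\<omega>. - X \<omega>)) {\<xi>}" .
  qed auto
  have "char_fun M X (- \<mu>) = (\<integral>k. iexp (\<mu> * of_int k) \<partial>distr M (count_space UNIV) (\<lambda>\<omega>. - X \<omega>))"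
    by (simp add: char_fun_eq[OF X] integral_distr)
  also have "\<dots> = char_fun M X \<mu>"
    unfolding eq[symmetric] by (simp add: char_fun_eq[OF X] integral_distr)
  finally show ?thesis .
qed

lemma char_fun_add:
  assumes indep: "indep_var (count_space UNIV) X (count_space UNIV) Y"
  shows "char_fun M (\<lambda>\<omega>. X \<omega> + Y \<omega>) \<mu> = char_fun M X \<mu> * char_fun M Y \<mu>"
proof -
  have "indep_var borel (real_of_int \<circ> X) borel (real_of_int \<circ> Y)"
    by (rule indep_var_compose[OF indep]) auto
  from char_distr_add[OF this] show ?thesis
    by (simp add: char_fun_def comp_def)
qed

lemma log_char_properties:
  assumes X: "X \<in> measurable M (count_space (UNIV :: int set))" and nz: "\<And>\<mu>. char_fun M X \<mu> \<noteq> 0"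
  shows continuous_log_char: "continuous_on UNIV (log_char M X)"
    and log_char_0: "log_char M X 0 = 0"
    and exp_log_char: "exp (log_char M X \<mu>) = char_fun M X \<mu>"
proof -
  obtain g where g: "continuous_on UNIV g" "\<And>\<mu>. char_fun M X \<mu> = exp (g \<mu>)"
    by (rule continuous_logarithm_on_contractible[OF continuous_char_fun[OF X]
        convex_imp_contractible[OF convex_UNIV] nz]) simp
  have "exp (g 0) = 1"
    using g(2)[of 0] char_fun_0[OF X] by simp
  then have eq: "log_char M X = (\<lambda>\<mu>. g \<mu> - g 0)"
    by (intro log_char_unique continuous_intros g(1)) (auto simp: exp_diff g(2))
  show "continuous_on UNIV (log_char M X)" "log_char M X 0 = 0" "exp (log_char M X \<mu>) = char_fun M X \<mu>"
    unfolding eq using \<open>exp (g 0) = 1\<close> by (auto simp: exp_diff g(2) intro!: continuous_intros g(1))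
qed

lemma log_char_minus:
  assumes X: "X \<in> measurable M (count_space (UNIV :: int set))" and nz: "\<And>\<mu>. char_fun M X \<mu> \<noteq> 0"
  shows "log_char M X (- \<mu>) = cnj (log_char M X \<mu>)"
proof -
  note P = log_char_properties[OF X nz]
  have "log_char M X = (\<lambda>\<mu>. cnj (log_char M X (- \<mu>)))"
  proof (rule log_char_unique)
    show "continuous_on UNIV (\<lambda>\<mu>. cnj (log_char M X (- \<mu>)))"
      by (intro continuous_on_cnj continuous_on_compose2[OF P(1)] continuous_intros) auto
    show "char_fun M X \<mu> = exp (cnj (log_char M X (- \<mu>)))" for \<mu>
      by (simp only: exp_cnj[symmetric] P(3) char_fun_minus[OF X] complex_cnj_cnj)
  qed (simp add: P(2))
  from fun_cong[OF this, of "- \<mu>"] show ?thesis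
    by simp
qed

lemma log_char_even:
  assumes X: "X \<in> measurable M (count_space (UNIV :: int set))" and nz: "\<And>\<mu>. char_fun M X \<mu> \<noteq> 0"
    and sym: "\<And>\<xi>. prob_mass M X \<xi> = prob_mass M X (- \<xi>)"
  shows "log_char M X (- \<mu>) = log_char M X \<mu>"
proof -
  note P = log_char_properties[OF X nz]
  have "log_char M X = (\<lambda>\<mu>. log_char M X (- \<mu>))"
  proof (rule log_char_unique)
    show "continuous_on UNIV (\<lambda>\<mu>. log_char M X (- \<mu>))"
      by (intro continuous_on_compose2[OF P(1)] continuous_intros) auto
  qed (simp_all add: P(2,3) char_fun_even[OF X sym])
  from fun_cong[OF this, of "- \<mu>"] show ?thesis
    by simp
qed

lemma log_char_add:
  assumes X: "X \<in> measurable M (count_space (UNIV :: int set))" "\<And>\<mu>. char_fun M X \<mu> \<noteq> 0"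
    and Y: "Y \<in> measurable M (count_space (UNIV :: int set))" "\<And>\<mu>. char_fun M Y \<mu> \<noteq> 0"
    and indep: "indep_var (count_space UNIV) X (count_space UNIV) Y"
  shows "log_char M (\<lambda>\<omega>. X \<omega> + Y \<omega>) = (\<lambda>\<mu>. log_char M X \<mu> + log_char M Y \<mu>)"
proof (rule log_char_unique)
  show "continuous_on UNIV (\<lambda>\<mu>. log_char M X \<mu> + log_char M Y \<mu>)"
    by (intro continuous_on_add continuous_log_char X Y)
  show "log_char M X 0 + log_char M Y 0 = 0"
    by (simp add: log_char_0[OF X] log_char_0[OF Y])
  show "char_fun M (\<lambda>\<omega>. X \<omega> + Y \<omega>) \<mu> = exp (log_char M X \<mu> + log_char M Y \<mu>)" for \<mu>
    by (simp only: exp_add exp_log_char[OF X] exp_log_char[OF Y] char_fun_add[OF indep])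
qed

text \<open>For nearby \<open>x\<close> and \<open>y\<close>, uniform continuity of \<open>\<psi> = log \<Phi>\<close> makes \<open>\<psi> x - \<psi> y\<close> small, and then it is at most
  twice \<open>\<bar>exp (\<psi> x - \<psi> y) - 1\<bar> = \<bar>\<Phi> x - \<Phi> y\<bar> / \<bar>\<Phi> y\<bar>\<close>, where the denominator is bounded below by
  compactness. For distant points the boundedness of \<open>\<psi>\<close> is enough.\<close>

lemma log_char_lipschitz:
  assumes X: "X \<in> measurable M (count_space (UNIV :: int set))" and nz: "\<And>\<mu>. char_fun M X \<mu> \<noteq> 0"
    and int: "integrable M (\<lambda>\<omega>. real_of_int (X \<omega>))"
  obtains K where "K-lipschitz_on {a..b} (log_char M X)"
proof (cases "a \<le> b")
  case False
  then have "0-lipschitz_on {a..b} (log_char M X)" by (simp add: lipschitz_on_def)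
  then show ?thesis by (rule that)
next
  case True
  note P = log_char_properties[OF X nz]
  define \<psi> where "\<psi> = log_char M X"
  define \<Phi> where "\<Phi> = char_fun M X"
  define E where "E = expectation (\<lambda>\<omega>. \<bar>real_of_int (X \<omega>)\<bar>)"
  have "E \<ge> 0" by (simp add: E_def)
  have cont: "continuous_on {a..b} \<psi>" "continuous_on {a..b} (\<lambda>\<mu>. cmod (\<Phi> \<mu>))"
    unfolding \<psi>_def \<Phi>_def
    by (rule continuous_on_subset[OF P(1)], simp)
       (intro continuous_on_norm continuous_on_subset[OF continuous_char_fun[OF X]], simp)
  obtain x0 where x0: "x0 \<in> {a..b}" "\<And>x. x \<in> {a..b} \<Longrightarrow> cmod (\<Phi> x0) \<le> cmod (\<Phi> x)"
    using continuous_attains_inf[OF _ _ cont(2)] True by auto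
  define m where "m = cmod (\<Phi> x0)"
  have "m > 0" using nz by (simp add: m_def \<Phi>_def)
  \<comment> \<open>\<open>\<bar>z\<bar> \<le> 1 / 2\<close> is the range in which \<open>\<bar>z\<bar> \<le> 2 * \<bar>exp z - 1\<bar>\<close> is used.\<close>
  obtain \<delta> where \<delta>: "\<delta> > 0"
      "\<And>x y. x \<in> {a..b} \<Longrightarrow> y \<in> {a..b} \<Longrightarrow> dist x y < \<delta> \<Longrightarrow> dist (\<psi> x) (\<psi> y) < 1 / 2"
    using compact_uniformly_continuous[OF cont(1)] unfolding uniformly_continuous_on_def
    by (metis compact_Icc dist_commute half_gt_zero_iff zero_less_one)
  have "bounded (\<psi> ` {a..b})"
    by (intro compact_imp_bounded compact_continuous_image cont) auto
  then obtain B where B: "B > 0" "\<And>x. x \<in> {a..b} \<Longrightarrow> cmod (\<psi> x) \<le> B"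
    unfolding bounded_pos by blast
  define K where "K = max (2 * E / m) (2 * B / \<delta>)"
  have "K-lipschitz_on {a..b} \<psi>"
  proof (rule lipschitz_onI)
    show "0 \<le> K" using \<open>B > 0\<close> \<open>\<delta> > 0\<close> by (simp add: K_def le_max_iff_disj)
    fix x y assume xy: "x \<in> {a..b}" "y \<in> {a..b}"
    show "dist (\<psi> x) (\<psi> y) \<le> K * dist x y"
    proof (cases "dist x y < \<delta>")
      case True
      have "cmod (\<psi> x - \<psi> y) \<le> 2 * cmod (exp (\<psi> x - \<psi> y) - 1)"
        using norm_exp_bounds(1)[of "\<psi> x - \<psi> y"] \<delta>(2)[OF xy True] by (simp add: dist_norm)
      also have "exp (\<psi> x - \<psi> y) - 1 = (\<Phi> x - \<Phi> y) / \<Phi> y"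
        using nz by (simp add: exp_diff \<psi>_def \<Phi>_def P(3) field_simps)
      also have "2 * cmod \<dots> \<le> 2 * (E * \<bar>x - y\<bar> / m)"
        unfolding norm_divide using char_fun_lipschitz[OF X int, of x y] x0(2)[OF xy(2)] \<open>m > 0\<close> \<open>E \<ge> 0\<close>
        by (intro mult_left_mono frac_le) (auto simp: E_def \<Phi>_def m_def)
      also have "\<dots> = 2 * E / m * dist x y"
        by (simp add: dist_real_def)
      also have "\<dots> \<le> K * dist x y"
        by (intro mult_right_mono) (auto simp: K_def)
      finally show ?thesis by (simp add: dist_norm)
    next
      case False
      have "dist (\<psi> x) (\<psi> y) \<le> 2 * B"
        using norm_triangle_ineq4[of "\<psi> x" "\<psi> y"] B(2)[OF xy(1)] B(2)[OF xy(2)] by (simp add: dist_norm)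
      also have "\<dots> = 2 * B / \<delta> * \<delta>"
        using \<open>\<delta> > 0\<close> by simp
      also have "\<dots> \<le> K * dist x y"
        using False \<open>\<delta> > 0\<close> \<open>B > 0\<close> by (intro mult_mono) (auto simp: K_def le_max_iff_disj)
      finally show ?thesis .
    qed
  qed
  then show ?thesis unfolding \<psi>_def by (rule that)
qed

text \<open>The real part of the muculant of index \<open>0\<close> is the mean of \<open>ln \<bar>\<Phi>\<bar>\<close>, which is nonpositive.\<close>

lemma muculant_0_le:
  assumes X: "X \<in> measurable M (count_space (UNIV :: int set))" and nz: "\<And>\<mu>. char_fun M X \<mu> \<noteq> 0"
  shows "Re (muculant M X 0) \<le> 0"
proof -
  have cont: "continuous_on {-pi..pi} (log_char M X)"
    by (rule continuous_on_subset[OF continuous_log_char[OF X nz]]) simp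
  have "Re (integral {-pi..pi} (log_char M X)) = integral {-pi..pi} (\<lambda>\<mu>. Re (log_char M X \<mu>))"
    using integral_linear[OF integrable_continuous_real[OF cont] bounded_linear_Re] by (simp add: comp_def)
  also have "\<dots> \<le> integral {-pi..pi} (\<lambda>_. 0)"
  proof (rule integral_le)
    show "(\<lambda>\<mu>. Re (log_char M X \<mu>)) integrable_on {-pi..pi}"
      by (intro integrable_continuous_real continuous_intros cont)
    show "Re (log_char M X \<mu>) \<le> 0" for \<mu>
      using cmod_char_fun_le_1[OF X, of \<mu>] nz[of \<mu>] by (simp add: log_char_def)
  qed (rule integrable_0)
  finally show ?thesis
    by (simp add: muculant_def mult_nonneg_nonpos divide_nonpos_pos)
qed

end

section \<open>The properties of the muculants\<close>

theorem theorem1: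
  fixes M :: "'a measure" and X :: "'a \<Rightarrow> int"
  assumes "prob_space M"
    and "X \<in> measurable M (count_space UNIV)"
    and "\<forall>\<mu>. char_fun M X \<mu> \<noteq> 0"
  shows "(\<forall>n. muculant M X n \<in> \<real>) \<and>
    Re (muculant M X 0) \<le> 0 \<and>
    ((\<forall>\<xi>. prob_mass M X \<xi> = prob_mass M X (- \<xi>)) \<longrightarrow>
      (\<forall>n. muculant M X n = muculant M X (- n))) \<and>
    (integrable M (\<lambda>\<omega>. real_of_int (X \<omega>)) \<longrightarrow>
      (\<lambda>N::nat. \<Sum>n = - int N..int N. muculant M X n) \<longlonglongrightarrow> 0 \<and>
      (\<forall>\<mu>. convergent (fourier_partial_sum (muculant M X) \<mu>)) \<and>
      (\<forall>\<mu>\<in>{-pi<..<pi}. fourier_partial_sum (muculant M X) \<mu> \<longlonglongrightarrow> log_char M X \<mu>) \<and>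
      (\<forall>\<mu>\<in>{-pi, pi}. fourier_partial_sum (muculant M X) \<mu> \<longlonglongrightarrow>
         (log_char M X (-pi) + log_char M X pi) / 2)) \<and>
    (muculant M X \<longlongrightarrow> 0) at_top \<and> (muculant M X \<longlongrightarrow> 0) at_bot \<and>
    (integrable M (\<lambda>\<omega>. real_of_int (X \<omega>)) \<longrightarrow>
      muculant M X \<in> O[at_top](\<lambda>n. 1 / of_int n) \<and>
      muculant M X \<in> O[at_bot](\<lambda>n. 1 / of_int n)) \<and>
    (\<forall>Y. Y \<in> measurable M (count_space UNIV) \<longrightarrow>
      (\<forall>\<mu>. char_fun M Y \<mu> \<noteq> 0) \<longrightarrow>
      prob_space.indep_var M (count_space UNIV) X (count_space UNIV) Y \<longrightarrow>
      (\<forall>n. muculant M (\<lambda>\<omega>. X \<omega> + Y \<omega>) n = muculant M X n + muculant M Y n))"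
proof (intro conjI impI allI)
  interpret prob_space M by fact
  note X = \<open>X \<in> measurable M (count_space UNIV)\<close>
  have nz: "\<And>\<mu>. char_fun M X \<mu> \<noteq> 0" using assms(3) by blast
  note P = log_char_properties[OF X nz]
  have contI: "continuous_on {-pi..pi} (log_char M X)"
    by (rule continuous_on_subset[OF P(1)]) simp
  have borel: "log_char M X \<in> borel_measurable borel"
    by (intro borel_measurable_continuous_onI P(1))
  show "muculant M X n \<in> \<real>" for n
  proof -
    have "fourier_coeff (\<lambda>\<mu>. log_char M X (- \<mu>)) (- n) = cnj (fourier_coeff (log_char M X) n)"
      by (simp add: log_char_minus[OF X nz] fourier_coeff_cnj)
    then have "muculant M X n = cnj (muculant M X n)"
      by (simp add: fourier_coeff_reflect muculant_eq_fourier_coeff)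
    then show ?thesis by (simp add: Reals_cnj_iff)
  qed
  show "Re (muculant M X 0) \<le> 0"
    by (rule muculant_0_le[OF X nz])
  show "muculant M X n = muculant M X (- n)" if "\<forall>\<xi>. prob_mass M X \<xi> = prob_mass M X (- \<xi>)" for n
    using fourier_coeff_reflect[of "log_char M X" n] log_char_even[OF X nz] that
    by (simp add: muculant_eq_fourier_coeff)
  have "(fourier_coeff (log_char M X) \<longlongrightarrow> 0) cofinite"
    by (intro riemann_lebesgue borel compact_imp_bounded compact_continuous_image contI) auto
  then show "(muculant M X \<longlongrightarrow> 0) at_top" "(muculant M X \<longlongrightarrow> 0) at_bot"
    unfolding muculant_eq_fourier_coeff
    using tendsto_mono int_at_top_le_cofinite int_at_bot_le_cofinite by blast+
  show "muculant M (\<lambda>\<omega>. X \<omega> + Y \<omega>) n = muculant M X n + muculant M Y n"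
    if Y: "Y \<in> measurable M (count_space UNIV)" "\<forall>\<mu>. char_fun M Y \<mu> \<noteq> 0"
      "indep_var (count_space UNIV) X (count_space UNIV) Y" for Y n
  proof -
    have "continuous_on {-pi..pi} (log_char M Y)"
      using Y(2) by (intro continuous_on_subset[OF continuous_log_char[OF Y(1)]]) auto
    then show ?thesis
      unfolding muculant_eq_fourier_coeff
      using Y log_char_add[OF X nz Y(1) _ Y(3)] contI by (simp add: fourier_coeff_add)
  qed
  assume int: "integrable M (\<lambda>\<omega>. real_of_int (X \<omega>))"
  obtain K where K: "K-lipschitz_on {-2 * pi..2 * pi} (log_char M X)"
    using log_char_lipschitz[OF X nz int] .
  have K': "K-lipschitz_on {-pi..pi} (log_char M X)"
    by (rule lipschitz_on_subset[OF K]) auto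
  show "muculant M X \<in> O[at_top](\<lambda>n. 1 / of_int n)" "muculant M X \<in> O[at_bot](\<lambda>n. 1 / of_int n)"
    unfolding muculant_eq_fourier_coeff by (intro fourier_coeff_bigo[OF P(1) K])+
  have interior: "fourier_partial_sum (muculant M X) \<mu> \<longlonglongrightarrow> log_char M X \<mu>" if "\<mu> \<in> {-pi<..<pi}" for \<mu>
    unfolding muculant_eq_fourier_coeff by (rule fourier_partial_sum_tendsto_interior[OF borel K' that])
  have endpoint: "fourier_partial_sum (muculant M X) \<mu> \<longlonglongrightarrow> (log_char M X (-pi) + log_char M X pi) / 2"
    if "\<mu> \<in> {-pi, pi}" for \<mu>
    unfolding muculant_eq_fourier_coeff by (rule fourier_partial_sum_tendsto_endpoint[OF P(1) K' that])
  show "\<forall>\<mu>\<in>{-pi<..<pi}. fourier_partial_sum (muculant M X) \<mu> \<longlonglongrightarrow> log_char M X \<mu>"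
    using interior by blast
  show "\<forall>\<mu>\<in>{-pi, pi}. fourier_partial_sum (muculant M X) \<mu> \<longlonglongrightarrow>
         (log_char M X (-pi) + log_char M X pi) / 2"
    using endpoint by blast
  show "(\<lambda>N::nat. \<Sum>n = - int N..int N. muculant M X n) \<longlonglongrightarrow> 0"
    using interior[of 0] by (simp add: fourier_partial_sum_def[abs_def] P(2))
  show "convergent (fourier_partial_sum (muculant M X) \<mu>)" for \<mu>
  proof -
    \<comment> \<open>The partial sums are \<open>2 \<pi>\<close>-periodic, so \<open>\<mu>\<close> can be moved to \<open>\<nu>\<close> in \<open>[-\<pi>, \<pi>)\<close>.\<close>
    define k where "k = \<lfloor>(\<mu> + pi) / (2 * pi)\<rfloor>"
    define \<nu> where "\<nu> = \<mu> - 2 * pi * of_int k"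
    have "of_int k \<le> (\<mu> + pi) / (2 * pi)" "(\<mu> + pi) / (2 * pi) < of_int k + 1"
      unfolding k_def by linarith+
    then have \<nu>: "-pi \<le> \<nu>" "\<nu> < pi"
      by (auto simp: \<nu>_def field_simps)
    have "exp (\<i> * complex_of_real \<mu> * of_int n) = exp (\<i> * complex_of_real \<nu> * of_int n)" for n
      unfolding exp_eq by (intro exI[of _ "k * n"]) (simp add: \<nu>_def algebra_simps)
    then have "fourier_partial_sum (muculant M X) \<mu> = fourier_partial_sum (muculant M X) \<nu>"
      by (simp add: fourier_partial_sum_def fun_eq_iff)
    moreover have "convergent (fourier_partial_sum (muculant M X) \<nu>)"
      using interior[of \<nu>] endpoint[of \<nu>] \<nu> by (cases "\<nu> = -pi") (auto simp: convergent_def)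
    ultimately show ?thesis by simp
  qed
qed

end
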